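(* Let $q$ be a power of an odd prime. For any $a \in \mathbb{F}_{q^3}^\star$, the polynomial \[ f_a(X) = X^{q+1} + a^{-1}(X^q + X) + \mathrm{N}(a^{-1})\,(\mathrm{Tr}(a) - 2a) \in \mathbb{F}_{q^3}[X] \] splits completely in $\mathbb{F}_{q^3}^\star$ (i.e., it factors into linear factors over $\mathbb{F}_{q^3}$ and all its roots are nonzero elements of $\mathbb{F}_{q^3}$). Furthermore, if $a \in \mathbb{F}_q^\star$, then $f_a(X)$ has a single root of multiplicity $q+1$, and if $a \in \mathbb{F}_{q^3} \setminus \mathbb{F}_q$, then the roots of $f_a(X)$ are all distinct.
   Context: $\mathbb{F}_{q}$ denotes the finite field with $q$ elements and $\mathbb{F}_q^\star$ its set of nonzero elements; $\mathbb{F}_q$ is regarded as a subfield of $\mathbb{F}_{q^3}$. $\mathrm{N}$ and $\mathrm{Tr}$ are the norm and trace maps from $\mathbb{F}_{q^3}$ to $\mathbb{F}_q$: $\mathrm{N}(x) = x^{1+q+q^2}$ and $\mathrm{Tr}(x) = x + x^q + x^{q^2}$ for $x \in \mathbb{F}_{q^3}$. *)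

theory Defs
  imports "HOL-Computational_Algebra.Computational_Algebra" "HOL-Library.Cardinality"
begin

definition is_subfield :: "'a::field set \<Rightarrow> bool" where
  "is_subfield K \<longleftrightarrow>
     0 \<in> K \<and> 1 \<in> K \<and>
     (\<forall>x\<in>K. \<forall>y\<in>K. x + y \<in> K \<and> x * y \<in> K) \<and>
     (\<forall>x\<in>K. - x \<in> K \<and> inverse x \<in> K)"

text \<open>
  Norm and trace of the cubic extension of the field with \<open>q\<close> elements. The type \<^typ>\<open>'a\<close>
  plays the role of the big field with \<open>q ^ 3\<close> elements, and the values are left in \<^typ>\<open>'a\<close>.
\<close>

definition norm3 :: "nat \<Rightarrow> 'a::field \<Rightarrow> 'a" where
  "norm3 q x = x ^ (1 + q + q ^ 2)"

definition trace3 :: "nat \<Rightarrow> 'a::field \<Rightarrow> 'a" where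
  "trace3 q x = x + x ^ q + x ^ (q ^ 2)"

definition f_poly :: "nat \<Rightarrow> 'a::field \<Rightarrow> 'a poly" where
  "f_poly q a =
     monom 1 (q + 1) + smult (inverse a) (monom 1 q + monom 1 1)
     + [:norm3 q (inverse a) * (trace3 q a - 2 * a):]"

text \<open>
  The list \<open>rs\<close> enumerates the roots with multiplicity, so \<open>p\<close> is a product of linear factors
  over the coefficient field and all its roots (in any extension field) lie in \<open>S\<close>.
\<close>

definition splits_in :: "'a::field poly \<Rightarrow> 'a set \<Rightarrow> bool" where
  "splits_in p S \<longleftrightarrow>
     p \<noteq> 0 \<and>
     (\<exists>rs. set rs \<subseteq> S \<and> p = smult (lead_coeff p) (\<Prod>r\<leftarrow>rs. [:- r, 1:]))"

end

theory Submission
  imports Defs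
begin

text \<open>
  Write \<open>b = a ^ q\<close> and \<open>c = a ^ q\<^sup>2\<close>. Up to the factor \<open>a * b * c\<close>, the equation \<open>f\<^sub>a(x) = 0\<close>
  says that \<open>x ^ q = M x\<close> for a Moebius transformation \<open>M\<close> over the big field. If \<open>M'\<close>, \<open>M''\<close> are the
  Frobenius conjugates of \<open>M\<close>, then \<open>M' M\<close> is a scalar multiple of \<open>M''\<close>, and \<open>M''\<close> has trace zero,
  so \<open>M'' M' M\<close> is the scalar \<open>a b c (a - b) (c - a) (c - b)\<close>. Hence \<open>x ^ q\<^sup>3 = x\<close> modulo
  \<open>f\<^sub>a\<close>, that is, \<open>f\<^sub>a\<close> divides the product of all the \<open>X - x\<close>, as soon as this scalar is nonzero,
  which means \<open>a ^ q \<noteq> a\<close>. Otherwise \<open>f\<^sub>a = (X + 1 / a) ^ (q + 1)\<close>.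
\<close>

section \<open>Frobenius map, characteristic and subfields as fixed points\<close>

lemma freshmans_dream_diff:
  fixes x y :: "'a::comm_ring_1"
  assumes "prime CHAR('a)" and "m = CHAR('a) ^ n"
  shows "(x - y) ^ m = x ^ m - y ^ m"
  using freshmans_dream'[OF assms, of "x - y" y] by simp

text \<open>The shift by 1 permutes the field, so comparing the two sums over all elements gives
  that the cardinality is zero in the field.\<close>

lemma CHAR_eq_of_card_prime_power:
  assumes "prime p" and "CARD('a::{field,finite}) = p ^ k"
  shows "CHAR('a) = p"
proof -
  have "(\<Sum>y\<in>UNIV. y + 1 :: 'a) = (\<Sum>y\<in>UNIV. y)"
    by (rule sum.reindex_bij_witness[of _ "\<lambda>y. y - 1" "\<lambda>y. y + 1"]) auto
  then have "of_nat CARD('a) = (0 :: 'a)"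
    by (simp add: sum.distrib)
  then have "CHAR('a) dvd p ^ k"
    using assms(2) of_nat_eq_0_iff_char_dvd by metis
  moreover have "prime CHAR('a)"
    by (intro prime_CHAR_semidom finite_imp_CHAR_pos) simp
  ultimately show ?thesis
    using assms(1) prime_dvd_power primes_dvd_imp_eq by blast
qed

lemma is_subfield_UNIV: "is_subfield UNIV"
  by (simp add: is_subfield_def)

text \<open>Multiplication by a nonzero \<open>x\<close> permutes \<open>K - {0}\<close>; comparing
  the products over this set gives the exponent.\<close>

lemma subfield_power_card:
  fixes K :: "'a::field set"
  assumes "is_subfield K" and "finite K" and "x \<in> K"
  shows "x ^ card K = x"
proof (cases "x = 0")
  case True
  then show ?thesis using assms by (auto simp: card_gt_0_iff)
next
  case False
  have mem: "x * y \<in> K" "y / x \<in> K" if "y \<in> K" for y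
    using assms that by (auto simp: is_subfield_def divide_inverse)
  have "\<Prod>(K - {0}) = (\<Prod>y\<in>K - {0}. x * y)"
    by (rule prod.reindex_bij_witness[of _ "\<lambda>y. x * y" "\<lambda>y. y / x"]) (use False mem in auto)
  also have "\<dots> = x ^ card (K - {0}) * \<Prod>(K - {0})"
    by (simp add: prod.distrib)
  finally have "x ^ card (K - {0}) = 1"
    using assms(2) by simp
  then have "x ^ Suc (card (K - {0})) = x"
    by simp
  moreover have "Suc (card (K - {0})) = card K"
    using assms by (intro card_Suc_Diff1) (auto simp: is_subfield_def)
  ultimately show ?thesis by simp
qed

text \<open>All \<open>q\<close> elements of \<open>K\<close> are roots of \<open>X ^ q - X\<close>,
  which has at most \<open>q\<close> roots, so there are no others.\<close>

lemma subfield_eq_fixed_points: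
  fixes K :: "'a::field set"
  assumes "is_subfield K" and "finite K" and "card K = q" and "q > 1"
  shows "x \<in> K \<longleftrightarrow> x ^ q = x"
proof -
  define g :: "'a poly" where "g = monom 1 q - monom 1 1"
  have "coeff g q = 1"
    using assms(4) by (simp add: g_def)
  then have "g \<noteq> 0" by auto
  have "degree g \<le> q"
    unfolding g_def using assms(4) by (intro degree_diff_le) (auto simp: degree_monom_eq)
  have roots: "{y. poly g y = 0} = {y :: 'a. y ^ q = y}"
    by (auto simp: g_def poly_monom)
  have "K \<subseteq> {y. y ^ q = y}"
    using subfield_power_card assms by blast
  moreover have "finite {y :: 'a. y ^ q = y}"
    using poly_roots_finite[OF \<open>g \<noteq> 0\<close>] by (simp add: roots)
  moreover have "card {y :: 'a. y ^ q = y} \<le> card K"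
    using card_poly_roots_bound[OF \<open>g \<noteq> 0\<close>] \<open>degree g \<le> q\<close> assms(3) by (simp add: roots)
  ultimately have "K = {y. y ^ q = y}"
    by (meson card_seteq)
  then show ?thesis by blast
qed

section \<open>Products of linear factors and their divisors\<close>

lemma monom_card_minus_X_eq_prod:
  fixes m :: nat
  assumes "CARD('a::{field,finite}) = m" and "m > 1"
  shows "monom 1 m - monom 1 1 = (\<Prod>x\<in>(UNIV :: 'a set). [:- x, 1:])"
\<comment> \<open>Both sides are monic of degree \<open>m\<close> and vanish at all \<open>m\<close>
  field elements; their difference has smaller degree, hence is zero.\<close>
proof (rule poly_eqI_degree_lead_coeff[where A = UNIV and n = m])
  have deg: "degree (\<Prod>x\<in>(UNIV :: 'a set). [:- x, 1:]) = m"
    using assms by (subst degree_prod_eq_sum_degree) auto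
  moreover have "lead_coeff (\<Prod>x\<in>(UNIV :: 'a set). [:- x, 1:]) = 1"
    by (simp add: lead_coeff_prod)
  ultimately show "coeff (monom 1 m - monom 1 1) m = coeff (\<Prod>x\<in>(UNIV :: 'a set). [:- x, 1:]) m"
    using assms(2) by simp
  show "degree (\<Prod>x\<in>(UNIV :: 'a set). [:- x, 1:]) \<le> m"
    using deg by simp
  show "degree (monom 1 m - monom 1 1 :: 'a poly) \<le> m"
    using assms(2) by (intro degree_diff_le) (auto simp: degree_monom_eq)
  show "card (UNIV :: 'a set) \<ge> m"
    using assms(1) by simp
  show "poly (monom 1 m - monom 1 1) z = poly (\<Prod>x\<in>UNIV. [:- x, 1:]) z" for z :: 'a
    using subfield_power_card[OF is_subfield_UNIV, of z] assms(1)
    by (auto simp: poly_monom poly_prod)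
qed

lemma order_prod_linear_factors:
  fixes A :: "'a::field set"
  assumes "finite A" and "a \<in> A"
  shows "order a (\<Prod>x\<in>A. [:- x, 1:]) = 1"
proof -
  have "(\<Prod>x\<in>A. [:- x, 1:]) = [:- a, 1:] * (\<Prod>x\<in>A - {a}. [:- x, 1:])"
    using assms by (rule prod.remove)
  moreover have "[:- a, 1:] * (\<Prod>x\<in>A - {a}. [:- x, 1:]) \<noteq> 0"
    using assms(1) by (simp only: mult_eq_0_iff prod_zero_iff finite_Diff) simp
  moreover have "poly (\<Prod>x\<in>A - {a}. [:- x, 1:]) a \<noteq> 0"
    using assms(1) by (auto simp: poly_prod)
  moreover have "order a [:- a, 1:] = 1"
    using order_power_n_n[of a 1] by simp
  ultimately show ?thesis
    by (simp only: order_mult order_0I add_0_right simp_thms)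
qed

text \<open>Induction on \<open>rs\<close>: the head factor is either split off from
  \<open>f\<close> or, being prime, divides the cofactor and can be cancelled there.\<close>

lemma dvd_prod_list_linear_factors:
  fixes f :: "'a::field poly"
  assumes "f dvd (\<Prod>r\<leftarrow>rs. [:- r, 1:])"
  shows "\<exists>ss. f = smult (lead_coeff f) (\<Prod>r\<leftarrow>ss. [:- r, 1:])"
  using assms
proof (induction rs arbitrary: f)
  case Nil
  then have "degree f = 0"
    using is_unit_iff_degree[of f] by fastforce
  then have "f = smult (lead_coeff f) (\<Prod>r\<leftarrow>[]. [:- r, 1:])"
    by (auto elim: degree_eq_zeroE)
  then show ?case by (rule exI)
next
  case (Cons a rs)
  show ?case
  proof (cases "[:- a, 1:] dvd f")
    case True
    then obtain g where g: "f = [:- a, 1:] * g" by (auto simp: dvd_def)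
    then have "[:- a, 1:] * g dvd [:- a, 1:] * (\<Prod>r\<leftarrow>rs. [:- r, 1:])"
      using Cons.prems by simp
    then have "g dvd (\<Prod>r\<leftarrow>rs. [:- r, 1:])"
      by (subst (asm) dvd_mult_cancel_left) auto
    then obtain ss where "g = smult (lead_coeff g) (\<Prod>r\<leftarrow>ss. [:- r, 1:])"
      using Cons.IH by blast
    moreover have "lead_coeff f = lead_coeff g"
      unfolding g by (subst lead_coeff_mult) simp
    ultimately have "f = [:- a, 1:] * smult (lead_coeff f) (\<Prod>r\<leftarrow>ss. [:- r, 1:])"
      using g by simp
    then have "f = smult (lead_coeff f) (\<Prod>r\<leftarrow>a # ss. [:- r, 1:])"
      by (simp only: list.map prod_list.Cons mult_smult_right)
    then show ?thesis by (rule exI)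
  next
    case False
    obtain k where k: "[:- a, 1:] * (\<Prod>r\<leftarrow>rs. [:- r, 1:]) = f * k"
      using Cons.prems by (auto simp only: list.map prod_list.Cons elim: dvdE)
    then have "[:- a, 1:] dvd f * k"
      by (metis dvd_triv_left)
    moreover have "prime_elem [:- a, 1:]"
      by (simp add: prime_elem_linear_field_poly)
    ultimately have "[:- a, 1:] dvd k"
      using False by (simp add: prime_elem_dvd_mult_iff)
    then obtain m where "k = [:- a, 1:] * m"
      by (rule dvdE)
    then have "[:- a, 1:] * (\<Prod>r\<leftarrow>rs. [:- r, 1:]) = [:- a, 1:] * (f * m)"
      by (simp only: k mult.left_commute)
    then have "(\<Prod>r\<leftarrow>rs. [:- r, 1:]) = f * m"
      by (subst (asm) mult_cancel_left) simp
    then have "f dvd (\<Prod>r\<leftarrow>rs. [:- r, 1:])"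
      by (rule dvdI)
    then show ?thesis by (rule Cons.IH)
  qed
qed

lemma splits_in_if_dvd:
  fixes f :: "'a::field poly"
  assumes "f \<noteq> 0" and "f dvd (\<Prod>r\<leftarrow>rs. [:- r, 1:])" and "\<And>x. poly f x = 0 \<Longrightarrow> x \<in> S"
  shows "splits_in f S"
proof -
  obtain ss where ss: "f = smult (lead_coeff f) (\<Prod>r\<leftarrow>ss. [:- r, 1:])"
    using dvd_prod_list_linear_factors[OF assms(2)] by blast
  have "poly f r = 0" if "r \<in> set ss" for r
  proof -
    have "poly (\<Prod>r\<leftarrow>ss. [:- r, 1:]) r = 0"
      using that by (induction ss) auto
    then show ?thesis
      by (subst ss) simp
  qed
  then have "set ss \<subseteq> S"
    using assms(3) by blast
  then show ?thesis
    unfolding splits_in_def by (intro conjI exI[of _ ss] assms(1) ss)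
qed

text \<open>
  For fixed \<open>x\<close> the equation \<open>moeb_eq a b c x y = 0\<close> reads \<open>y = M x\<close>, with denominators cleared.
\<close>

definition moeb_eq :: "'a::comm_ring_1 \<Rightarrow> 'a \<Rightarrow> 'a \<Rightarrow> 'a \<Rightarrow> 'a \<Rightarrow> 'a" where
  "moeb_eq a b c x y = a * b * c * (x * y) + b * c * (x + y) + (b + c - a)"

section \<open>Iterating the Moebius relation along the Frobenius map\<close>

lemma moeb_eq_power:
  fixes a :: "'a::comm_ring_1"
  assumes "prime CHAR('a)" and "m = CHAR('a) ^ n"
  shows "moeb_eq a b c x y ^ m = moeb_eq (a ^ m) (b ^ m) (c ^ m) (x ^ m) (y ^ m)"
  unfolding moeb_eq_def
  by (simp add: freshmans_dream'[OF assms] freshmans_dream_diff[OF assms] power_mult_distrib)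

text \<open>Elimination of \<open>y\<close> from \<open>y = M x\<close> and \<open>z = M' y\<close>:
  each relation is multiplied by the coefficient of \<open>y\<close> in the other. What remains is
  the relation of \<open>M''\<close>.\<close>

lemma moeb_eq_compose:
  "c * (a - b) * moeb_eq c a b x z =
     (a * b * c * x + b * c) * moeb_eq b c a y z - (a * b * c * z + c * a) * moeb_eq a b c x y"
  unfolding moeb_eq_def by (simp add: algebra_simps)

text \<open>Elimination of \<open>z\<close> from \<open>z = M'' x\<close> and
  \<open>w = M'' z\<close>. As \<open>M''\<close> has trace zero, its square is the scalar minus its
  determinant, which is \<open>a * b * (c - a) * (c - b)\<close>.\<close>

lemma moeb_eq_involution:
  "a * b * (c - a) * (c - b) * (w - x) =
     (a * b * c * x + a * b) * moeb_eq c a b z w - (a * b * c * w + a * b) * moeb_eq c a b x z"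
  unfolding moeb_eq_def by (simp add: algebra_simps)

text \<open>Stated over a commutative ring so that it applies to polynomials, with \<open>x\<close>
  the indeterminate and \<open>a\<close>, \<open>b\<close>, \<open>c\<close> constants.\<close>

lemma dvd_moeb_eq_imp_dvd_diff:
  fixes a b c x :: "'a::comm_ring_1"
  assumes "prime CHAR('a)" and "q = CHAR('a) ^ n"
    and "b = a ^ q" and "c = b ^ q" and "a = c ^ q"
    and "f dvd moeb_eq a b c x (x ^ q)"
  shows "f dvd a * b * c * (a - b) * (c - a) * (c - b) * (x ^ q ^ 3 - x)"
proof -
  have "q > 0"
    using assms(1,2) by (simp add: prime_gt_0_nat)
  \<comment> \<open>A multiple of \<open>f\<close> divides its own \<open>q\<close>-th power, so the
    conjugate relation holds modulo the same \<open>f\<close>, which itself need not be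
    conjugated.\<close>
  have frob: "f dvd moeb_eq (u ^ q) (v ^ q) (w ^ q) (y ^ q) (z ^ q)"
    if "f dvd moeb_eq u v w y z" for u v w y z
    using that moeb_eq_power[OF assms(1,2)] \<open>q > 0\<close>
    by (metis dvd_power dvd_trans)
  have 1: "f dvd moeb_eq b c a (x ^ q) ((x ^ q) ^ q)"
    using frob[OF assms(6)] by (simp only: assms(3-5)[symmetric])
  have 2: "f dvd moeb_eq c a b ((x ^ q) ^ q) (((x ^ q) ^ q) ^ q)"
    using frob[OF 1] by (simp only: assms(3-5)[symmetric])
  have "f dvd c * (a - b) * moeb_eq c a b x ((x ^ q) ^ q)"
    unfolding moeb_eq_compose[of c a b x "(x ^ q) ^ q" "x ^ q"]
    by (intro dvd_diff dvd_mult 1 assms(6))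
  then have "f dvd (a * b * c * x + a * b) * (c * (a - b)) * moeb_eq c a b ((x ^ q) ^ q) (((x ^ q) ^ q) ^ q)
      - (a * b * c * ((x ^ q) ^ q) ^ q + a * b) * (c * (a - b) * moeb_eq c a b x ((x ^ q) ^ q))"
    by (rule dvd_diff[OF dvd_mult[OF 2] dvd_mult])
  also have "\<dots> = c * (a - b) *
      ((a * b * c * x + a * b) * moeb_eq c a b ((x ^ q) ^ q) (((x ^ q) ^ q) ^ q)
       - (a * b * c * ((x ^ q) ^ q) ^ q + a * b) * moeb_eq c a b x ((x ^ q) ^ q))"
    by (simp only: right_diff_distrib mult_ac)
  also have "\<dots> = c * (a - b) * (a * b * (c - a) * (c - b) * (((x ^ q) ^ q) ^ q - x))"
    by (simp only: moeb_eq_involution[symmetric])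
  also have "\<dots> = a * b * c * (a - b) * (c - a) * (c - b) * (((x ^ q) ^ q) ^ q - x)"
    by (simp only: mult_ac)
  also have "((x ^ q) ^ q) ^ q = x ^ q ^ 3"
    by (simp only: power_mult[symmetric] power3_eq_cube)
  finally show ?thesis .
qed

text \<open>The norm of \<open>1 / a\<close> is \<open>1 / (a * b * c)\<close>, and the trace of
  \<open>a\<close> minus \<open>2 * a\<close> is \<open>b + c - a\<close>.\<close>

lemma moeb_eq_eq_smult_f_poly:
  fixes a :: "'a::field"
  assumes "a \<noteq> 0" and "b = a ^ q" and "c = a ^ q ^ 2"
  shows "moeb_eq [:a:] [:b:] [:c:] (monom 1 1) (monom 1 1 ^ q) = smult (a * b * c) (f_poly q a)"
proof -
  have norm: "norm3 q (inverse a) = inverse (a * b * c)"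
    by (simp add: norm3_def assms power_add power_inverse flip: inverse_mult_distrib)
  have "trace3 q a - 2 * a = b + c - a"
    by (simp add: trace3_def assms)
  moreover have "(monom 1 1 :: 'a poly) ^ q = monom 1 q"
    by (simp add: monom_power)
  moreover have "a * b * c \<noteq> 0"
    using assms by simp
  ultimately show ?thesis
    using assms(1) unfolding moeb_eq_def f_poly_def norm
    by (simp add: smult_add_right mult_monom smult_monom field_simps)
qed

theorem theorem1p4:
  fixes p n q :: nat and Fq :: "'a::{field,finite} set" and a :: 'a
  assumes "prime p" and "odd p" and "n > 0" and "q = p ^ n"
    and "CARD('a) = q ^ 3"
    and "is_subfield Fq" and "card Fq = q"
    and "a \<noteq> 0"
  shows "splits_in (f_poly q a) (UNIV - {0}) \<and>
    (a \<in> Fq - {0} \<longrightarrow>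
       (\<exists>x. {y. poly (f_poly q a) y = 0} = {x} \<and> order x (f_poly q a) = q + 1)) \<and>
    (a \<in> UNIV - Fq \<longrightarrow>
       (\<forall>x. poly (f_poly q a) x = 0 \<longrightarrow> order x (f_poly q a) = 1))"
proof -
  define b where "b = a ^ q"
  define c where "c = a ^ q ^ 2"
  have char: "CHAR('a) = p"
    using CHAR_eq_of_card_prime_power[of p "n * 3"] assms(1,4,5) by (simp add: power_mult)
  have prime: "prime CHAR('a)" and q: "q = CHAR('a) ^ n"
    using assms(1,4) char by simp_all
  have "q > 1"
    using one_less_power[OF prime_gt_1_nat[OF assms(1)] assms(3)] assms(4) by simp
  have "q ^ 3 > 1"
    using \<open>q > 1\<close> by (intro one_less_power) auto
  have bq: "b ^ q = c"
    by (simp only: b_def c_def power2_eq_square power_mult)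
  have "c ^ q = a ^ q ^ 3"
    by (simp only: c_def power_mult[symmetric] power3_eq_cube power2_eq_square)
  then have cq: "c ^ q = a"
    using subfield_power_card[OF is_subfield_UNIV, of a] assms(5) by simp
  have nz: "b \<noteq> 0" "c \<noteq> 0"
    using assms(8) by (auto simp: b_def c_def)
  have Fq: "a \<in> Fq \<longleftrightarrow> b = a"
    using subfield_eq_fixed_points[of Fq q a] assms(6,7) \<open>q > 1\<close> by (simp add: b_def)
  have f_moeb: "moeb_eq [:a:] [:b:] [:c:] (monom 1 1) (monom 1 1 ^ q) = smult (a * b * c) (f_poly q a)"
    using moeb_eq_eq_smult_f_poly assms(8) b_def c_def by blast
  have root_nz: "x \<noteq> 0" if "poly (f_poly q a) x = 0" for x
  proof
    assume "x = 0"
    have "poly (moeb_eq [:a:] [:b:] [:c:] (monom 1 1) (monom 1 1 ^ q)) x = 0"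
      unfolding f_moeb using that by simp
    then have a: "b + c = a"
      using \<open>q > 1\<close> \<open>x = 0\<close> by (simp add: moeb_eq_def poly_monom power_0_left)
    \<comment> \<open>Conjugating \<open>b + c = a\<close> gives \<open>c + a = b\<close>; together
      they force \<open>2 * c = 0\<close>, impossible in odd characteristic.\<close>
    then have "(b + c) ^ q = a ^ q"
      by simp
    then have "c + a = b"
      using freshmans_dream'[OF prime q, of b c] bq cq by (simp add: b_def)
    moreover have "2 * c = (b + c - a) + (c + a - b)"
      by simp
    ultimately have "2 * c = 0"
      using a by simp
    then have "of_nat 2 = (0 :: 'a)"
      using nz by simp
    then have "p dvd 2"
      using of_nat_eq_0_iff_char_dvd char by metis
    then show False
      using assms(2) primes_dvd_imp_eq[OF assms(1) two_is_prime_nat] by simp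
  qed
  show ?thesis
  proof (cases "a \<in> Fq")
    case True
    then have eq: "b = a" "c = a"
      using Fq bq b_def by metis+
    define r where "r = - inverse a"
    \<comment> \<open>The Frobenius map fixes \<open>1 / a\<close>, so the \<open>q\<close>-th power
      of \<open>X + 1 / a\<close> is \<open>X ^ q + 1 / a\<close>.\<close>
    have "[:inverse a, 1:] ^ q = [:inverse a:] ^ q + monom 1 1 ^ q"
      using freshmans_dream'[of q n "[:inverse a:]" "monom 1 1"] prime q by (simp add: monom_altdef)
    also have "\<dots> = [:inverse a:] + monom 1 q"
      using eq(1) by (simp add: poly_const_pow power_inverse b_def monom_power)
    finally have "[:inverse a, 1:] ^ (q + 1) = ([:inverse a:] + monom 1 q) * ([:inverse a:] + monom 1 1)"
      by (simp add: monom_altdef)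
    also have "smult (a * b * c) \<dots> = moeb_eq [:a:] [:b:] [:c:] (monom 1 1) (monom 1 1 ^ q)"
      using assms(8) unfolding moeb_eq_def eq
      by (simp add: monom_power algebra_simps smult_add_right mult_monom smult_monom)
    finally have "smult (a * b * c) ([:inverse a, 1:] ^ (q + 1)) = smult (a * b * c) (f_poly q a)"
      unfolding f_moeb .
    moreover have "a * b * c \<noteq> 0"
      using assms(8) nz by simp
    ultimately have "[:inverse a, 1:] ^ (q + 1) = f_poly q a"
      by (simp only: smult_eq_iff divide_self smult_1_left simp_thms)
    then have f: "f_poly q a = [:- r, 1:] ^ (q + 1)"
      by (simp only: r_def minus_minus)
    then have f_nz: "f_poly q a \<noteq> 0"
      by (simp only: power_eq_0_iff pCons_eq_0_iff) simp
    have roots: "{y. poly (f_poly q a) y = 0} = {r}"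
      by (auto simp: f)
    have "f_poly q a dvd (\<Prod>s\<leftarrow>replicate (q + 1) r. [:- s, 1:])"
      unfolding f by (simp add: prod_list_replicate)
    then have "splits_in (f_poly q a) (UNIV - {0})"
      by (rule splits_in_if_dvd[rotated]) (use f_nz root_nz in auto)
    moreover have "order r (f_poly q a) = q + 1"
      unfolding f by (rule order_power_n_n)
    ultimately show ?thesis
      using True roots by blast
  next
    case False
    then have ab: "a - b \<noteq> 0"
      using Fq by simp
    \<comment> \<open>The three differences are conjugate, so none vanishes once
      \<open>a - b\<close> does not.\<close>
    moreover have "(a - b) ^ q = b - c" "(b - c) ^ q = c - a"
      using freshmans_dream_diff[OF prime q] bq cq by (simp_all add: b_def)
    ultimately have nz': "c - a \<noteq> 0" "c - b \<noteq> 0"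
      by (auto simp: power_0_left)
    let ?l = "a * b * c * (a - b) * (c - a) * (c - b)"
    have "f_poly q a dvd [:a:] * [:b:] * [:c:] * ([:a:] - [:b:]) * ([:c:] - [:a:]) * ([:c:] - [:b:])
            * (monom 1 1 ^ q ^ 3 - monom 1 1)"
    proof (rule dvd_moeb_eq_imp_dvd_diff)
      show "f_poly q a dvd moeb_eq [:a:] [:b:] [:c:] (monom 1 1) (monom 1 1 ^ q)"
        unfolding f_moeb by (simp add: dvd_smult)
    qed (use prime q bq cq in \<open>simp_all add: poly_const_pow b_def\<close>)
    also have "\<dots> = smult ?l (monom 1 (q ^ 3) - monom 1 1)"
      by (simp add: monom_power mult_ac)
    finally have "f_poly q a dvd monom 1 (q ^ 3) - monom 1 1"
      using assms(8) nz nz' ab by (simp add: dvd_smult_iff)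
    then have dvd: "f_poly q a dvd (\<Prod>x\<in>(UNIV :: 'a set). [:- x, 1:])"
      using monom_card_minus_X_eq_prod[OF assms(5) \<open>q ^ 3 > 1\<close>] by simp
    have prod_nz: "(\<Prod>x\<in>(UNIV :: 'a set). [:- x, 1:]) \<noteq> 0"
      by simp
    have f_nz: "f_poly q a \<noteq> 0"
      using dvd prod_nz by (metis dvd_0_left)
    obtain rs :: "'a list" where "set rs = UNIV" "distinct rs"
      using finite_distinct_list[of "UNIV :: 'a set"] by auto
    then have "f_poly q a dvd (\<Prod>r\<leftarrow>rs. [:- r, 1:])"
      using dvd by (metis prod.distinct_set_conv_list)
    then have "splits_in (f_poly q a) (UNIV - {0})"
      by (rule splits_in_if_dvd[rotated]) (use f_nz root_nz in auto)
    moreover have "order x (f_poly q a) = 1" if "poly (f_poly q a) x = 0" for x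
    proof -
      \<comment> \<open>A divisor of a product of distinct linear factors has only simple
        roots.\<close>
      have "order x (f_poly q a) \<le> 1"
        using dvd_imp_order_le[OF prod_nz dvd, of x] order_prod_linear_factors[of UNIV x] by simp
      moreover have "order x (f_poly q a) > 0"
        using that f_nz by (simp add: order_gt_0_iff)
      ultimately show ?thesis by simp
    qed
    ultimately show ?thesis
      using False by blast
  qed
qed

end
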